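(* There is a constant $C>0$ such that for all $n\ge 1$, $$\mathrm{d_{TV}}\left(\mathbb{M}_n,\ \mathbf{M}_{\mathcal{U}_{2n}}\right)\le \frac{C}{n},$$ where $\mathbb{M}_n$ is a uniform random labeled map with $n$ edges, and $\mathbf{M}_{\mathcal{U}_{2n}}$ is the random labeled map obtained by first sampling the multiset $\mathcal{U}_{2n}$ of cycle lengths of a uniform random permutation of $\{1,\dots,2n\}$ and then performing a uniform random labeling and gluing of the sides of oriented polygons whose perimeters are given by $\mathcal{U}_{2n}$.
   Context: $\mathfrak{S}_{2n}$ is the symmetric group on $\{1,\dots,2n\}$ and $\mathcal{I}_{2n}\subset\mathfrak{S}_{2n}$ is the set of involutions without fixed points. A labeled map with $n$ edges (connected, on an oriented surface, oriented edges labeled by $1,\dots,2n$, genus unconstrained) is encoded by, and identified with, a pair $(\alpha,\phi)\in\mathcal{I}_{2n}\times\mathfrak{S}_{2n}$ such that the subgroup generated by $\alpha$ and $\phi$ acts transitively on $\{1,\dots,2n\}$: $\alpha$ pairs the oriented edges into edges, and the cycles of $\phi$ are the oriented edges around each face. Random gluing: for a finite multiset $\mathcal{P}=\{p_1,\dots,p_k\}$ of positive integers with sum $2n$, take $k$ oriented polygons of perimeters $p_1,\dots,p_k$, label their $2n$ sides by $1,\dots,2n$ uniformly at random (let $\phi\in\mathfrak{S}_{2n}$ be the permutation sending each side to the next one around its polygon), and glue the sides in pairs, respecting orientations, according to an independent uniform $\alpha\in\mathcal{I}_{2n}$. If the resulting surface is connected, $\mathbf{M}_{\mathcal{P}}$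 is the resulting labeled map, i.e. the pair $(\alpha,\phi)$; otherwise $\mathbf{M}_{\mathcal{P}}$ is set equal to a fixed cemetery point. If $\mathcal P$ is random, one first samples $\mathcal{P}$ and then performs the gluing. $\mathrm{d_{TV}}(X,Y)=\sup_A|\mathbb{P}(X\in A)-\mathbb{P}(Y\in A)|$ is the total variation distance between the laws of $X$ and $Y$. *)

theory Defs
  imports
    "HOL-Probability.Probability"
    "HOL-Combinatorics.Orbits"
    "HOL-Algebra.Sym_Groups"
begin

definition fpf_involutions :: "nat \<Rightarrow> (nat \<Rightarrow> nat) set" where
  "fpf_involutions m =
     {\<alpha>. \<alpha> permutes {1..m} \<and> (\<forall>i\<in>{1..m}. \<alpha> (\<alpha> i) = i \<and> \<alpha> i \<noteq> i)}"

definition labeled_maps :: "nat \<Rightarrow> ((nat \<Rightarrow> nat) \<times> (nat \<Rightarrow> nat)) set" where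
  "labeled_maps n =
     {(\<alpha>, \<phi>). \<alpha> \<in> fpf_involutions (2 * n) \<and> \<phi> permutes {1..2 * n} \<and>
        (\<forall>i\<in>{1..2 * n}. \<forall>j\<in>{1..2 * n}. \<exists>g\<in>generate (sym_group (2 * n)) {\<alpha>, \<phi>}. g i = j)}"

definition uniform_labeled_map :: "nat \<Rightarrow> ((nat \<Rightarrow> nat) \<times> (nat \<Rightarrow> nat)) pmf" where
  "uniform_labeled_map n = pmf_of_set (labeled_maps n)"

text \<open>The pair \<open>(i, j)\<close> is the \<open>j\<close>-th side, in cyclic order, of the \<open>i\<close>-th polygon. The polygons
  are listed by increasing perimeter; since the sides are then labeled uniformly, this choice
  does not affect the law of the gluing.\<close>

definition polygon_sides :: "nat multiset \<Rightarrow> (nat \<times> nat) set" where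
  "polygon_sides P = (let ps = sorted_list_of_multiset P in
     {(i, j). i < length ps \<and> j < ps ! i})"

definition next_side :: "nat multiset \<Rightarrow> nat \<times> nat \<Rightarrow> nat \<times> nat" where
  "next_side P = (\<lambda>(i, j). (i, Suc j mod (sorted_list_of_multiset P ! i)))"

definition side_labelings :: "nat multiset \<Rightarrow> (nat \<times> nat \<Rightarrow> nat) set" where
  "side_labelings P =
     {l. l \<in> extensional (polygon_sides P) \<and> bij_betw l (polygon_sides P) {1..\<Sum>\<^sub># P}}"

definition face_perm :: "nat multiset \<Rightarrow> (nat \<times> nat \<Rightarrow> nat) \<Rightarrow> nat \<Rightarrow> nat" where
  "face_perm P l = (\<lambda>x. if x \<in> {1..\<Sum>\<^sub># P}
     then l (next_side P (inv_into (polygon_sides P) l x)) else x)"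

text \<open>The value \<open>None\<close> is the cemetery point. The definition is meaningful for multisets of
  positive integers with sum \<open>2 * n\<close>. The glued surface is connected iff
  the group generated by \<open>\<alpha>\<close> and \<open>\<phi>\<close> acts transitively on the sides, that is,
  iff \<open>(\<alpha>, \<phi>)\<close> is a labeled map.\<close>

definition polygon_gluing ::
    "nat \<Rightarrow> nat multiset \<Rightarrow> ((nat \<Rightarrow> nat) \<times> (nat \<Rightarrow> nat)) option pmf" where
  "polygon_gluing n P = do {
     l \<leftarrow> pmf_of_set (side_labelings P);
     \<alpha> \<leftarrow> pmf_of_set (fpf_involutions (2 * n));
     let \<phi> = face_perm P l;
     return_pmf (if (\<alpha>, \<phi>) \<in> labeled_maps n then Some (\<alpha>, \<phi>) else None)
   }"

text \<open>Fixed points are included as cycles of length \<open>1\<close>, since \<open>orbit \<sigma> x = {x}\<close> if \<open>\<sigma> x = x\<close>.\<close>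

definition cycle_lengths :: "nat \<Rightarrow> (nat \<Rightarrow> nat) \<Rightarrow> nat multiset" where
  "cycle_lengths m \<sigma> = image_mset card (mset_set (orbit \<sigma> ` {1..m}))"

definition uniform_cycle_lengths :: "nat \<Rightarrow> nat multiset pmf" where
  "uniform_cycle_lengths m = map_pmf (cycle_lengths m) (pmf_of_set {\<sigma>. \<sigma> permutes {1..m}})"

definition tv_dist :: "'a pmf \<Rightarrow> 'a pmf \<Rightarrow> real" where
  "tv_dist p q = (SUP A. \<bar>measure_pmf.prob p A - measure_pmf.prob q A\<bar>)"

end

theory Submission
  imports Defs
begin

text \<open>
  Label the polygons along the cycles of \<open>\<sigma>\<close>, so that the face permutation is \<open>\<sigma>\<close> itself; a uniform
  labeling is this one followed by a uniform \<open>\<tau>\<close>, and its face permutation is \<open>\<tau> \<sigma> \<tau>\<inverse>\<close>. For fixed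
  \<open>\<tau>\<close> this is uniform when \<open>\<sigma>\<close> is, so the gluing of \<open>\<U>\<^bsub>2n\<^esub>\<close> is a uniform pair \<open>(\<alpha>, \<phi>)\<close>, sent to the
  cemetery when the pair is disconnected, and the total variation distance is at most the
  probability of disconnectedness.

  A disconnected pair has a common invariant set of some size \<open>2k\<close> with \<open>0 < k < n\<close>. Each \<open>\<alpha>\<close>
  preserves \<open>n choose k\<close> such sets, and a uniform \<open>\<phi>\<close> preserves a given one with probability
  \<open>1 / (2n choose 2k)\<close>. Since \<open>(n choose k)\<^sup>2 \<le> 2n choose 2k\<close>, the probability of disconnectedness is
  at most the sum of \<open>1 / (n choose k)\<close>, hence at most \<open>4 / n\<close>.
\<close>

section \<open>Labelings realising a given permutation\<close>

text \<open>Reads a cycle as a polygon: side \<open>j\<close> is the \<open>j\<close>-th iterate of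
  a chosen starting point, and the second claim closes the polygon up after its last side.\<close>

lemma bij_betw_funpow_orbit:
  assumes "x \<in> orbit f x"
  shows "bij_betw (\<lambda>j. (f ^^ j) x) {..<card (orbit f x)} (orbit f x)"
    and "(f ^^ card (orbit f x)) x = x"
proof -
  have img: "orbit f x = (\<lambda>n. (f ^^ n) x) ` {0..<funpow_dist1 f x x}"
    by (rule orbit_conv_funpow_dist1[OF assms])
  have inj: "inj_on (\<lambda>n. (f ^^ n) x) {0..<funpow_dist1 f x x}"
    by (rule inj_on_funpow_dist1[OF assms])
  have card: "card (orbit f x) = funpow_dist1 f x x"
    using card_image[OF inj] img by simp
  show "bij_betw (\<lambda>j. (f ^^ j) x) {..<card (orbit f x)} (orbit f x)"
    using img inj unfolding bij_betw_def card lessThan_atLeast0 by blast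
  show "(f ^^ card (orbit f x)) x = x"
    using funpow_dist1_prop[OF assms] unfolding card .
qed

text \<open>Perimeters come as a sorted list. This lifts that list to an enumeration of the cycles
  themselves, so that polygon number \<open>i\<close> can be matched with an actual cycle.\<close>

lemma image_mset_eq_mset_obtain:
  assumes "image_mset f M = mset ys"
  obtains xs where "mset xs = M" "map f xs = ys"
proof -
  have "\<exists>xs. mset xs = M \<and> map f xs = ys" using assms
  proof (induction ys arbitrary: M)
    case (Cons y ys)
    obtain N a where N: "M = add_mset a N" "f a = y" "image_mset f N = mset ys"
      using msed_map_invR[of f M y "mset ys"] Cons.prems by auto
    obtain xs where "mset xs = N" "map f xs = ys" using Cons.IH[OF N(3)] by blast
    then have "mset (a # xs) = M \<and> map f (a # xs) = y # ys" using N by simp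
    then show ?case by (rule exI)
  qed auto
  then show thesis using that by blast
qed

lemma permutes_atLeastAtMost_self_in_orbit:
  fixes \<sigma> :: "nat \<Rightarrow> nat"
  assumes "\<sigma> permutes {1..m}"
  shows "x \<in> orbit \<sigma> x"
  using assms by (intro permutation_self_in_orbit) (auto simp: permutation_permutes)

lemma disjoint_orbits:
  assumes "permutation f" "z \<in> orbit f x" "z \<in> orbit f y"
  shows "orbit f x = orbit f y"
  using assms by (metis cyclic_on_orbit' orbit_cyclic_eq3)

text \<open>Enumerate the cycles in the order of the sorted perimeters, choose a point
  \<open>r i\<close> on each, and give side \<open>(i, j)\<close> the label reached from
  \<open>r i\<close> after \<open>j\<close> steps of \<open>\<sigma>\<close>. Passing to the next
  side is then one application of \<open>\<sigma>\<close>.\<close>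

lemma cycle_labeling_exists:
  assumes \<sigma>: "\<sigma> permutes {1..m}"
  defines "P \<equiv> cycle_lengths m \<sigma>"
  obtains l where "bij_betw l (polygon_sides P) {1..m}"
    "\<And>s. s \<in> polygon_sides P \<Longrightarrow> next_side P s \<in> polygon_sides P"
    "\<And>s. s \<in> polygon_sides P \<Longrightarrow> l (next_side P s) = \<sigma> (l s)"
proof -
  define ps where "ps = sorted_list_of_multiset P"
  have perm: "permutation \<sigma>" using \<sigma> by (auto simp: permutation_permutes)
  note self = permutes_atLeastAtMost_self_in_orbit[OF \<sigma>]
  have "image_mset card (mset_set (orbit \<sigma> ` {1..m})) = mset ps"
    by (simp add: ps_def P_def cycle_lengths_def)
  then obtain os where os: "mset os = mset_set (orbit \<sigma> ` {1..m})" "map card os = ps"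
    by (rule image_mset_eq_mset_obtain)
  \<comment> \<open>Cycles of equal length must remain separate polygons. \<open>mset_set\<close>
    has multiplicities at most 1, so no cycle is listed twice.\<close>
  have dist: "distinct os"
    using os(1) by (metis count_mset_set' distinct_count_atmost_1 finite_set_mset finite_set_mset_mset_set
        finite_imageI finite_atLeastAtMost set_mset_mset)
  have set_os: "set os = orbit \<sigma> ` {1..m}"
    using os(1) by (metis finite_set_mset_mset_set finite_imageI finite_atLeastAtMost set_mset_mset)
  have "\<forall>i<length os. \<exists>x\<in>{1..m}. os ! i = orbit \<sigma> x"
    using set_os by (metis (no_types, lifting) imageE nth_mem)
  then obtain r where r: "\<And>i. i < length os \<Longrightarrow> r i \<in> {1..m}"
    "\<And>i. i < length os \<Longrightarrow> os ! i = orbit \<sigma> (r i)" by metis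
  have len: "length ps = length os" and nth: "\<And>i. i < length os \<Longrightarrow> ps ! i = card (orbit \<sigma> (r i))"
    using os(2) r(2) by (auto simp flip: os(2))
  have sides: "polygon_sides P = (SIGMA i:{..<length os}. {..<card (orbit \<sigma> (r i))})"
    unfolding polygon_sides_def Let_def ps_def[symmetric] len using nth by auto
  have pos: "card (orbit \<sigma> x) > 0" for x
    using finite_orbit[OF self] self by (metis card_gt_0_iff orbit_nonempty)
  define l where "l = (\<lambda>(i, j). (\<sigma> ^^ j) (r i))"
  have in_orb: "(\<sigma> ^^ j) (r i) \<in> orbit \<sigma> (r i)" for i j
    by (intro funpow_in_orbit self)
  show thesis
  proof
    show "bij_betw l (polygon_sides P) {1..m}"
    proof (rule bij_betw_imageI)
      show "inj_on l (polygon_sides P)"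
      proof (rule inj_onI)
        fix s t assume s: "s \<in> polygon_sides P" and t: "t \<in> polygon_sides P" and eq: "l s = l t"
        obtain i j where ij: "s = (i, j)" "i < length os" "j < card (orbit \<sigma> (r i))"
          using s sides by auto
        obtain i' j' where ij': "t = (i', j')" "i' < length os" "j' < card (orbit \<sigma> (r i'))"
          using t sides by auto
        have e: "(\<sigma> ^^ j) (r i) = (\<sigma> ^^ j') (r i')" using eq ij ij' by (simp add: l_def)
        have "orbit \<sigma> (r i) = orbit \<sigma> (r i')"
          using disjoint_orbits[OF perm in_orb[of j i]] in_orb[of j' i'] e by simp
        then have "os ! i = os ! i'" using r(2) ij ij' by simp
        then have ii: "i = i'" using dist ij ij' by (simp add: nth_eq_iff_index_eq)
        then show "s = t" using bij_betw_funpow_orbit(1)[OF self, of "r i"] e ij ij'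
          by (auto simp: bij_betw_def inj_on_def)
      qed
      show "l ` polygon_sides P = {1..m}"
      proof (intro equalityI subsetI)
        fix x assume "x \<in> l ` polygon_sides P"
        then obtain i j where "i < length os" "x = (\<sigma> ^^ j) (r i)" by (auto simp: sides l_def)
        then show "x \<in> {1..m}"
          using in_orb[of j i] permutes_orbit_subset[OF \<sigma> r(1)] by blast
      next
        fix x assume "x \<in> {1..m}"
        then obtain i where i: "i < length os" "os ! i = orbit \<sigma> x"
          using set_os by (metis imageI in_set_conv_nth)
        then have "x \<in> orbit \<sigma> (r i)" using r(2) self by metis
        then obtain j where "j < card (orbit \<sigma> (r i))" "x = (\<sigma> ^^ j) (r i)"
          using bij_betw_funpow_orbit(1)[OF self, of "r i"] by (auto simp: bij_betw_def image_def)
        then show "x \<in> l ` polygon_sides P" using i by (force simp: sides l_def)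
      qed
    qed
    fix s assume "s \<in> polygon_sides P"
    then obtain i j where ij: "s = (i, j)" "i < length os" "j < card (orbit \<sigma> (r i))"
      using sides by auto
    have ns: "next_side P s = (i, Suc j mod card (orbit \<sigma> (r i)))"
      using ij nth by (simp add: next_side_def ps_def)
    show "next_side P s \<in> polygon_sides P"
      unfolding ns sides using ij pos by auto
    \<comment> \<open>The reduction modulo the perimeter matters only at the last side, where the
      iterates of \<open>\<sigma>\<close> return to \<open>r i\<close> as well.\<close>
    have "(\<sigma> ^^ (Suc j mod card (orbit \<sigma> (r i)))) (r i) = (\<sigma> ^^ Suc j) (r i)"
      by (rule funpow_mod_eq[OF bij_betw_funpow_orbit(2)[OF self]])
    then show "l (next_side P s) = \<sigma> (l s)" unfolding ns using ij by (simp add: l_def)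
  qed
qed

text \<open>The cycles partition the label set. This identifies the range of labels used by
  \<open>side_labelings\<close> and \<open>face_perm\<close>, which is given through the sum of the
  perimeters, with \<open>{1..m}\<close>.\<close>

lemma sum_mset_cycle_lengths:
  assumes "\<sigma> permutes {1..m}"
  shows "\<Sum>\<^sub># (cycle_lengths m \<sigma>) = m"
proof -
  have perm: "permutation \<sigma>" using assms by (auto simp: permutation_permutes)
  note self = permutes_atLeastAtMost_self_in_orbit[OF assms]
  have "\<Sum>\<^sub># (cycle_lengths m \<sigma>) = (\<Sum>A\<in>orbit \<sigma> ` {1..m}. card A)"
    by (simp add: cycle_lengths_def sum_unfold_sum_mset)
  also have "\<dots> = card (\<Union> (orbit \<sigma> ` {1..m}))"
  proof (rule card_Union_disjoint[symmetric])
    show "pairwise disjnt (orbit \<sigma> ` {1..m})"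
      unfolding pairwise_def disjnt_def using disjoint_orbits[OF perm] by blast
    show "finite A" if "A \<in> orbit \<sigma> ` {1..m}" for A using that finite_orbit[OF self] by auto
  qed
  also have "\<Union> (orbit \<sigma> ` {1..m}) = {1..m}"
    using permutes_orbit_subset[OF assms] self by blast
  finally show ?thesis by simp
qed

section \<open>The law of the gluing\<close>

lemma permutations_nonempty: "{p. p permutes A} \<noteq> {}"
  using permutes_id by blast

text \<open>Permutations of the labels act freely and transitively on the labelings, so a uniform
  labeling is any fixed one followed by a uniform permutation. \<open>restrict\<close> picks the
  extensional representative.\<close>

lemma bij_betw_relabel:
  assumes l: "bij_betw l S A"
  shows "bij_betw (\<lambda>\<tau>. restrict (\<tau> \<circ> l) S) {\<tau>. \<tau> permutes A}
    {l'. l' \<in> extensional S \<and> bij_betw l' S A}"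
proof (rule bij_betw_imageI)
  show "inj_on (\<lambda>\<tau>. restrict (\<tau> \<circ> l) S) {\<tau>. \<tau> permutes A}"
  proof (rule inj_onI, rule ext)
    fix \<tau> \<tau>' x assume \<tau>: "\<tau> \<in> {\<tau>. \<tau> permutes A}" and \<tau>': "\<tau>' \<in> {\<tau>. \<tau> permutes A}"
      and eq: "restrict (\<tau> \<circ> l) S = restrict (\<tau>' \<circ> l) S"
    show "\<tau> x = \<tau>' x"
    proof (cases "x \<in> A")
      case True
      then obtain s where "s \<in> S" "x = l s" using l by (auto simp: bij_betw_def)
      then show ?thesis using fun_cong[OF eq, of s] by simp
    next
      case False then show ?thesis using \<tau> \<tau>' by (simp add: permutes_def)
    qed
  qed
  show "(\<lambda>\<tau>. restrict (\<tau> \<circ> l) S) ` {\<tau>. \<tau> permutes A} = {l'. l' \<in> extensional S \<and> bij_betw l' S A}"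
  proof (intro equalityI subsetI)
    fix l' assume "l' \<in> (\<lambda>\<tau>. restrict (\<tau> \<circ> l) S) ` {\<tau>. \<tau> permutes A}"
    then obtain \<tau> where "\<tau> permutes A" "l' = restrict (\<tau> \<circ> l) S" by auto
    then show "l' \<in> {l'. l' \<in> extensional S \<and> bij_betw l' S A}"
      using bij_betw_trans[OF l permutes_imp_bij] by simp
  next
    fix l' assume l': "l' \<in> {l'. l' \<in> extensional S \<and> bij_betw l' S A}"
    \<comment> \<open>The only candidate: undo \<open>l\<close>, then apply \<open>l'\<close>,
      extended by the identity outside \<open>A\<close>.\<close>
    define \<tau> where "\<tau> = (\<lambda>x. if x \<in> A then (l' \<circ> inv_into S l) x else x)"
    have "bij_betw (l' \<circ> inv_into S l) A A"
      using bij_betw_trans[OF bij_betw_inv_into[OF l]] l' by blast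
    then have "bij_betw \<tau> A A" by (subst bij_betw_cong[of A _ "l' \<circ> inv_into S l"]) (auto simp: \<tau>_def)
    then have "\<tau> permutes A" by (rule bij_imp_permutes) (simp add: \<tau>_def)
    moreover have "l' = restrict (\<tau> \<circ> l) S"
    proof
      fix s show "l' s = restrict (\<tau> \<circ> l) S s"
        using l l' by (cases "s \<in> S")
          (auto simp: \<tau>_def bij_betw_def inv_into_f_f extensional_def)
    qed
    ultimately show "l' \<in> (\<lambda>\<tau>. restrict (\<tau> \<circ> l) S) ` {\<tau>. \<tau> permutes A}" by blast
  qed
qed

text \<open>The side with old label \<open>y\<close> now has label \<open>\<tau> y\<close>, and its
  successor has label \<open>\<tau> (\<sigma> y)\<close>. Relabeling therefore conjugates the face
  permutation.\<close>

lemma face_perm_relabel: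
  assumes l: "bij_betw l (polygon_sides P) {1..m}" and m: "\<Sum>\<^sub># P = m"
    and closed: "\<And>s. s \<in> polygon_sides P \<Longrightarrow> next_side P s \<in> polygon_sides P"
    and step: "\<And>s. s \<in> polygon_sides P \<Longrightarrow> l (next_side P s) = \<sigma> (l s)"
    and \<sigma>: "\<sigma> permutes {1..m}" and \<tau>: "\<tau> permutes {1..m}"
  shows "face_perm P (restrict (\<tau> \<circ> l) (polygon_sides P)) = \<tau> \<circ> \<sigma> \<circ> inv' \<tau>"
proof
  fix x
  let ?S = "polygon_sides P" let ?l = "restrict (\<tau> \<circ> l) ?S"
  have bij: "bij_betw ?l ?S {1..m}"
    using bij_betw_trans[OF l permutes_imp_bij[OF \<tau>]] by simp
  show "face_perm P ?l x = (\<tau> \<circ> \<sigma> \<circ> inv' \<tau>) x"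
  proof (cases "x \<in> {1..m}")
    case True
    define s where "s = inv_into ?S ?l x"
    have s: "s \<in> ?S" "?l s = x"
      using True bij unfolding s_def bij_betw_def by (metis inv_into_into, metis f_inv_into_f)
    have "face_perm P ?l x = ?l (next_side P s)"
      using True m by (simp add: face_perm_def s_def)
    also have "\<dots> = \<tau> (\<sigma> (l s))" using closed[OF s(1)] step[OF s(1)] by simp
    also have "l s = inv' \<tau> x" using s permutes_inverses(2)[OF \<tau>] by auto
    finally show ?thesis unfolding comp_apply[of _ "inv' \<tau>"] comp_apply[of \<tau> \<sigma>] .
  next
    case False
    then have "inv' \<tau> x = x" "\<sigma> x = x" "\<tau> x = x"
      using permutes_inv[OF \<tau>] \<sigma> \<tau> by (auto intro: permutes_not_in)
    then show ?thesis using False m by (auto simp: face_perm_def)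
  qed
qed

lemma map_pmf_face_perm:
  assumes \<sigma>: "\<sigma> permutes {1..m}"
  shows "map_pmf (face_perm (cycle_lengths m \<sigma>)) (pmf_of_set (side_labelings (cycle_lengths m \<sigma>)))
    = map_pmf (\<lambda>\<tau>. \<tau> \<circ> \<sigma> \<circ> inv' \<tau>) (pmf_of_set {\<tau>. \<tau> permutes {1..m}})"
proof -
  let ?P = "cycle_lengths m \<sigma>" let ?S = "polygon_sides ?P"
  obtain l where l: "bij_betw l ?S {1..m}"
    "\<And>s. s \<in> ?S \<Longrightarrow> next_side ?P s \<in> ?S"
    "\<And>s. s \<in> ?S \<Longrightarrow> l (next_side ?P s) = \<sigma> (l s)"
    using cycle_labeling_exists[OF \<sigma>] by metis
  note m = sum_mset_cycle_lengths[OF \<sigma>]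
  have fin: "finite {\<tau>. \<tau> permutes {1..m}}" by (rule finite_permutations) simp
  note ne = permutations_nonempty[of "{1..m}"]
  have "pmf_of_set (side_labelings ?P) =
      map_pmf (\<lambda>\<tau>. restrict (\<tau> \<circ> l) ?S) (pmf_of_set {\<tau>. \<tau> permutes {1..m}})"
    unfolding side_labelings_def m
    by (rule map_pmf_of_set_bij_betw[OF bij_betw_relabel[OF l(1)] ne fin, symmetric])
  then show ?thesis
    using face_perm_relabel[OF l(1) m l(2,3) \<sigma>]
    by (simp only: map_pmf_comp) (rule map_pmf_cong, use set_pmf_of_set[OF ne fin] in auto)
qed

lemma map_pmf_conjugation:
  assumes \<tau>: "\<tau> permutes A" and fin: "finite A"
  shows "map_pmf (\<lambda>\<sigma>. \<tau> \<circ> \<sigma> \<circ> inv' \<tau>) (pmf_of_set {\<sigma>. \<sigma> permutes A}) = pmf_of_set {\<sigma>. \<sigma> permutes A}"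
proof (rule map_pmf_of_set_bij_betw)
  have 1: "\<tau> \<circ> (inv' \<tau> \<circ> \<sigma> \<circ> \<tau>) \<circ> inv' \<tau> = \<sigma>" "inv' \<tau> \<circ> (\<tau> \<circ> \<sigma> \<circ> inv' \<tau>) \<circ> \<tau> = \<sigma>" for \<sigma>
    using permutes_inverses[OF \<tau>] by (auto simp: fun_eq_iff)
  show "bij_betw (\<lambda>\<sigma>. \<tau> \<circ> \<sigma> \<circ> inv' \<tau>) {\<sigma>. \<sigma> permutes A} {\<sigma>. \<sigma> permutes A}"
    by (rule bij_betw_byWitness[where f' = "\<lambda>\<sigma>. inv' \<tau> \<circ> \<sigma> \<circ> \<tau>"])
      (use 1 \<tau> permutes_inv[OF \<tau>] in \<open>auto intro!: permutes_compose\<close>)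
qed (rule permutations_nonempty, rule finite_permutations[OF fin])

lemma uniform_face_perm:
  "bind_pmf (uniform_cycle_lengths m) (\<lambda>P. map_pmf (face_perm P) (pmf_of_set (side_labelings P)))
    = pmf_of_set {\<sigma>. \<sigma> permutes {1..m}}" (is "?lhs = ?U")
proof -
  have fin: "finite {\<tau>. \<tau> permutes {1..m}}" by (rule finite_permutations) simp
  note ne = permutations_nonempty[of "{1..m}"]
  have "?lhs = bind_pmf ?U (\<lambda>\<sigma>. map_pmf (\<lambda>\<tau>. \<tau> \<circ> \<sigma> \<circ> inv' \<tau>) ?U)"
    unfolding uniform_cycle_lengths_def bind_map_pmf
    by (rule bind_pmf_cong[OF refl]) (use fin ne in \<open>simp add: map_pmf_face_perm\<close>)
  \<comment> \<open>For fixed \<open>\<sigma>\<close> the conjugate stays in one conjugacy class and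
    is not uniform on all permutations. Exchanging the two independent draws fixes
    \<open>\<tau>\<close> instead, and conjugation by a fixed \<open>\<tau>\<close> is a bijection
    of the symmetric group.\<close>
  also have "\<dots> = bind_pmf ?U (\<lambda>\<tau>. map_pmf (\<lambda>\<sigma>. \<tau> \<circ> \<sigma> \<circ> inv' \<tau>) ?U)"
    unfolding map_pmf_def by (rule bind_commute_pmf)
  also have "\<dots> = bind_pmf ?U (\<lambda>\<tau>. ?U)"
    by (rule bind_pmf_cong[OF refl]) (use fin ne in \<open>simp add: map_pmf_conjugation\<close>)
  finally show ?thesis by simp
qed

lemma fpf_involutions_nonempty: "fpf_involutions (2 * n) \<noteq> {}"
proof -
  \<comment> \<open>The witness swaps \<open>2i - 1\<close> and \<open>2i\<close>. Nonemptiness is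
    what gives \<open>pmf_of_set\<close> its meaning here.\<close>
  define \<alpha> where "\<alpha> = (\<lambda>x::nat. if x \<in> {1..2 * n} then if odd x then x + 1 else x - 1 else x)"
  have mem: "\<alpha> x \<in> {1..2 * n}" if "x \<in> {1..2 * n}" for x
    using that unfolding \<alpha>_def atLeastAtMost_iff by presburger
  have inv: "\<alpha> (\<alpha> x) = x" for x
  proof (cases "x \<in> {1..2 * n}")
    case True
    have *: "odd (\<alpha> x) \<longleftrightarrow> even x" "x \<ge> 1" using True by (auto simp: \<alpha>_def)
    have "\<alpha> (\<alpha> x) = (if odd (\<alpha> x) then \<alpha> x + 1 else \<alpha> x - 1)"
      using mem[OF True] unfolding \<alpha>_def[THEN fun_cong, of "\<alpha> x"] by simp
    also have "\<dots> = x" using * True by (auto simp: \<alpha>_def)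
    finally show ?thesis .
  next
    case False
    then have "\<alpha> x = x" unfolding \<alpha>_def by (rule if_not_P)
    then show ?thesis by simp
  qed
  have "bij_betw \<alpha> {1..2 * n} {1..2 * n}"
    by (rule bij_betw_byWitness[where f' = \<alpha>]) (use inv mem in auto)
  then have "\<alpha> permutes {1..2 * n}" by (rule bij_imp_permutes) (simp only: \<alpha>_def if_False)
  moreover have "\<alpha> i \<noteq> i" if "i \<in> {1..2 * n}" for i using that by (auto simp: \<alpha>_def)
  ultimately have "\<alpha> \<in> fpf_involutions (2 * n)" using inv by (auto simp: fpf_involutions_def)
  then show ?thesis by blast
qed

lemma finite_fpf_involutions: "finite (fpf_involutions m)"
  by (rule finite_subset[OF _ finite_permutations[of "{1..m}"]]) (auto simp: fpf_involutions_def)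

lemma pair_pmf_of_set:
  assumes "finite A" "A \<noteq> {}" "finite B" "B \<noteq> {}"
  shows "pair_pmf (pmf_of_set A) (pmf_of_set B) = pmf_of_set (A \<times> B)"
proof (rule pmf_eqI)
  fix z :: "'a \<times> 'b"
  have "A \<times> B \<noteq> {}" "finite (A \<times> B)" using assms by auto
  then show "pmf (pair_pmf (pmf_of_set A) (pmf_of_set B)) z = pmf (pmf_of_set (A \<times> B)) z"
    by (cases z) (simp add: pmf_pair assms card_cartesian_product indicator_times)
qed

text \<open>The involution is drawn independently of the perimeters and labeling, which affect the
  result only through the face permutation. Grouping those two draws together allows
  \<open>uniform_face_perm\<close> to replace them by one uniform permutation.\<close>

lemma law_of_gluing:
  "bind_pmf (uniform_cycle_lengths (2 * n)) (polygon_gluing n) =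
    map_pmf (\<lambda>x. if x \<in> labeled_maps n then Some x else None)
      (pmf_of_set (fpf_involutions (2 * n) \<times> {\<sigma>. \<sigma> permutes {1..2 * n}}))"
proof -
  let ?I = "pmf_of_set (fpf_involutions (2 * n))" and ?U = "pmf_of_set {\<sigma>. \<sigma> permutes {1..2 * n}}"
  let ?f = "\<lambda>x. if x \<in> labeled_maps n then Some x else None"
  have fin: "finite {\<tau>. \<tau> permutes {1..2 * n}}" by (rule finite_permutations) simp
  note ne = permutations_nonempty[of "{1..2 * n}"]
  have "bind_pmf (uniform_cycle_lengths (2 * n)) (polygon_gluing n) =
      bind_pmf (bind_pmf (uniform_cycle_lengths (2 * n))
        (\<lambda>P. map_pmf (face_perm P) (pmf_of_set (side_labelings P))))
        (\<lambda>\<phi>. map_pmf (\<lambda>\<alpha>. ?f (\<alpha>, \<phi>)) ?I)"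
    by (simp add: polygon_gluing_def[abs_def] bind_assoc_pmf bind_map_pmf map_pmf_def Let_def bind_return_pmf)
  also have "\<dots> = bind_pmf ?U (\<lambda>\<phi>. map_pmf (\<lambda>\<alpha>. ?f (\<alpha>, \<phi>)) ?I)"
    by (simp only: uniform_face_perm)
  also have "\<dots> = bind_pmf ?I (\<lambda>\<alpha>. map_pmf (\<lambda>\<phi>. ?f (\<alpha>, \<phi>)) ?U)"
    unfolding map_pmf_def by (rule bind_commute_pmf)
  also have "\<dots> = map_pmf ?f (pair_pmf ?I ?U)"
    by (simp add: pair_pmf_def map_bind_pmf map_pmf_def bind_assoc_pmf bind_return_pmf)
  finally show ?thesis
    unfolding pair_pmf_of_set[OF finite_fpf_involutions fpf_involutions_nonempty fin ne] .
qed

section \<open>Total variation distance to a conditioned uniform law\<close>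

lemma tv_dist_le_1: "tv_dist p q \<le> 1"
  unfolding tv_dist_def
proof (rule cSUP_least)
  fix A
  show "\<bar>measure_pmf.prob p A - measure_pmf.prob q A\<bar> \<le> 1"
    using measure_pmf.prob_le_1[of p A] measure_pmf.prob_le_1[of q A]
      measure_nonneg[of p A] measure_nonneg[of q A] by linarith
qed simp

text \<open>Under the second law, mass moves from \<open>L\<close> to the point \<open>None\<close>
  in the proportion of \<open>W - L\<close> in \<open>W\<close>. No event can change its probability
  by more than the mass moved.\<close>

lemma tv_dist_uniform_subset_le:
  assumes fin: "finite W" and ne: "W \<noteq> {}" and L: "L \<subseteq> W"
  shows "tv_dist (map_pmf Some (pmf_of_set L))
      (map_pmf (\<lambda>x. if x \<in> L then Some x else None) (pmf_of_set W))
    \<le> real (card (W - L)) / real (card W)"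
proof (cases "L = {}")
  \<comment> \<open>For empty \<open>L\<close> the value of \<open>pmf_of_set L\<close> is
    unspecified, but the right-hand side is then 1, which bounds every total variation
    distance.\<close>
  case True
  then show ?thesis using tv_dist_le_1 fin ne by simp
next
  case False
  let ?f = "\<lambda>x. if x \<in> L then Some x else None"
  have finL: "finite L" using fin L finite_subset by blast
  define l w where "l = real (card L)" and "w = real (card W)"
  have l: "0 < l" "l \<le> w" using False finL fin L by (auto simp: l_def w_def card_gt_0_iff card_mono)
  have wl: "real (card (W - L)) = w - l"
    using card_Diff_subset[OF finL L] card_mono[OF fin L] by (simp add: l_def w_def)
  show ?thesis unfolding tv_dist_def
  proof (rule cSUP_least)
    fix A :: "'a option set"
    define a e where "a = real (card (L \<inter> Some -` A))" and "e = (if None \<in> A then 1 else 0 :: real)"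
    have p: "measure_pmf.prob (map_pmf Some (pmf_of_set L)) A = a / l"
      by (simp add: measure_pmf_of_set[OF False finL] a_def l_def)
    have "W \<inter> ?f -` A = (L \<inter> Some -` A) \<union> (if None \<in> A then W - L else {})"
      using L by (auto split: if_splits)
    moreover have "card \<dots> = card (L \<inter> Some -` A) + card (if None \<in> A then W - L else {})"
      by (rule card_Un_disjoint) (use fin finL in auto)
    ultimately have "real (card (W \<inter> ?f -` A)) = a + e * (w - l)"
      by (simp add: a_def e_def wl)
    then have q: "measure_pmf.prob (map_pmf ?f (pmf_of_set W)) A = (a + e * (w - l)) / w"
      by (simp add: measure_pmf_of_set[OF ne fin] w_def)
    have a: "0 \<le> a / l" "a / l \<le> 1"
      using l(1) card_mono[of L "L \<inter> Some -` A"] finL by (auto simp: a_def l_def)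
    \<comment> \<open>Here \<open>a / l\<close> is the conditional probability of \<open>A\<close>
      given \<open>L\<close>, and \<open>e\<close> is the indicator of \<open>None\<close> in
      \<open>A\<close>. Both lie in \<open>[0, 1]\<close>, so the first factor is at most 1 in
      absolute value.\<close>
    have "a / l - (a + e * (w - l)) / w = (a / l - e) * ((w - l) / w)"
      using l by (simp add: field_simps)
    moreover have "\<bar>a / l - e\<bar> \<le> 1" using a by (auto simp: e_def)
    moreover have "0 \<le> (w - l) / w" using l by simp
    ultimately have "\<bar>a / l - (a + e * (w - l)) / w\<bar> \<le> (w - l) / w"
      using mult_right_mono[of "\<bar>a / l - e\<bar>" 1 "(w - l) / w"] by (simp only: abs_mult abs_of_nonneg mult_1)
    then show "\<bar>measure_pmf.prob (map_pmf Some (pmf_of_set L)) A -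
        measure_pmf.prob (map_pmf ?f (pmf_of_set W)) A\<bar> \<le> real (card (W - L)) / real (card W)"
      unfolding p q wl w_def[symmetric] .
  qed simp
qed

section \<open>Counting disconnected pairs\<close>

text \<open>If no group element carries \<open>i\<close> to \<open>j\<close>, the orbit of
  \<open>i\<close> under the generated group is invariant, contains \<open>i\<close> and misses
  \<open>j\<close>.\<close>

lemma disconnected_invariant_set:
  assumes \<alpha>: "\<alpha> \<in> fpf_involutions (2 * n)" and \<phi>: "\<phi> permutes {1..2 * n}"
    and notin: "(\<alpha>, \<phi>) \<notin> labeled_maps n"
  obtains S where "S \<subset> {1..2 * n}" "S \<noteq> {}" "\<alpha> ` S = S" "\<phi> ` S = S"
proof -
  let ?G = "sym_group (2 * n)" and ?A = "{1..2 * n}"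
  have \<alpha>': "\<alpha> permutes ?A" using \<alpha> by (simp add: fpf_involutions_def)
  obtain i j where ij: "i \<in> ?A" "j \<in> ?A" "\<And>g. g \<in> generate ?G {\<alpha>, \<phi>} \<Longrightarrow> g i \<noteq> j"
    using notin \<alpha> \<phi> by (auto simp: labeled_maps_def)
  define S where "S = (\<lambda>g. g i) ` generate ?G {\<alpha>, \<phi>}"
  interpret G: group ?G by (rule sym_group_is_group)
  have perm: "g permutes ?A" if "g \<in> generate ?G {\<alpha>, \<phi>}" for g
    using G.generate_in_carrier[OF _ that] \<alpha>' \<phi> by (simp add: sym_group_carrier)
  have "g i \<in> ?A" if "g \<in> generate ?G {\<alpha>, \<phi>}" for g
    using permutes_in_image[OF perm[OF that]] ij(1) by blast
  then have sub: "S \<subseteq> ?A" unfolding S_def by blast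
  have closed: "h ` S \<subseteq> S" if "h \<in> {\<alpha>, \<phi>}" for h
  proof -
    have "(h \<circ> g) i \<in> S" if "g \<in> generate ?G {\<alpha>, \<phi>}" for g
      using generate.eng[OF generate.incl[OF \<open>h \<in> {\<alpha>, \<phi>}\<close>] that]
      unfolding S_def sym_group_mult by (rule rev_image_eqI) (rule refl)
    then show ?thesis unfolding S_def by auto
  qed
  have finS: "finite S" using sub finite_subset by blast
  show thesis
  proof
    have "j \<notin> S" using ij(3) by (auto simp: S_def)
    then show "S \<subset> ?A" using sub ij(2) by blast
    show "S \<noteq> {}" using generate.one by (auto simp: S_def)
    \<comment> \<open>An injective map sending a finite set into itself is onto it.\<close>
    show "\<alpha> ` S = S" "\<phi> ` S = S"
      using closed by (simp_all add: endo_inj_surj[OF finS] permutes_inj_on[OF \<alpha>'] permutes_inj_on[OF \<phi>])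
  qed
qed

text \<open>\<open>T\<close> holds the smaller element of each pair of \<open>\<alpha>\<close>
  inside \<open>S\<close>. It determines \<open>S\<close> and has half its size, so invariant sets
  have even size and can be counted through \<open>T\<close>.\<close>

lemma invariant_set_eq_pairs:
  fixes \<alpha> :: "nat \<Rightarrow> nat"
  assumes \<alpha>: "\<alpha> \<in> fpf_involutions m" and S: "S \<subseteq> {1..m}" "\<alpha> ` S = S"
  defines "T \<equiv> {x \<in> S. x < \<alpha> x}"
  shows "S = T \<union> \<alpha> ` T" and "card S = 2 * card T"
proof -
  have inv: "\<alpha> (\<alpha> x) = x" "\<alpha> x \<noteq> x" if "x \<in> S" for x
    using \<alpha> S that by (auto simp: fpf_involutions_def)
  show eq: "S = T \<union> \<alpha> ` T"
  proof (intro equalityI subsetI)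
    fix x assume x: "x \<in> S"
    show "x \<in> T \<union> \<alpha> ` T"
    proof (cases "x < \<alpha> x")
      case False
      then have "\<alpha> x \<in> T" using inv[OF x] x S by (auto simp: T_def)
      then show ?thesis using inv[OF x] by (metis UnI2 imageI)
    qed (use x in \<open>auto simp: T_def\<close>)
  qed (use S in \<open>auto simp: T_def\<close>)
  have finT: "finite T" using S finite_subset by (fastforce simp: T_def)
  have "T \<inter> \<alpha> ` T = {}" using inv by (fastforce simp: T_def)
  then have "card (T \<union> \<alpha> ` T) = card T + card (\<alpha> ` T)" using finT by (intro card_Un_disjoint) auto
  moreover have "card (\<alpha> ` T) = card T"
    by (rule card_image) (metis (no_types, lifting) T_def inj_onI inv(1) mem_Collect_eq)
  ultimately show "card S = 2 * card T" using eq by simp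
qed

lemma card_invariant_sets_le:
  assumes \<alpha>: "\<alpha> \<in> fpf_involutions (2 * n)"
  shows "card {S. S \<subseteq> {1..2 * n} \<and> \<alpha> ` S = S \<and> card S = 2 * k} \<le> n choose k"
proof -
  let ?R = "{x \<in> {1..2 * n}. x < \<alpha> x}" and ?T = "\<lambda>S. {x \<in> S. x < \<alpha> x}"
  have "\<alpha> ` {1..2 * n} = {1..2 * n}" using \<alpha> by (auto simp: fpf_involutions_def dest: permutes_image)
  \<comment> \<open>The whole label set is itself invariant, so exactly \<open>n\<close> of its
    points are the smaller ones in their pairs.\<close>
  then have R: "card ?R = n" using invariant_set_eq_pairs(2)[OF \<alpha> subset_refl] by simp
  have "card {S. S \<subseteq> {1..2 * n} \<and> \<alpha> ` S = S \<and> card S = 2 * k} \<le> card {T. T \<subseteq> ?R \<and> card T = k}"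
  proof (rule card_inj_on_le)
    show "inj_on ?T {S. S \<subseteq> {1..2 * n} \<and> \<alpha> ` S = S \<and> card S = 2 * k}"
    proof (rule inj_onI)
      fix S S' assume S: "S \<in> {S. S \<subseteq> {1..2 * n} \<and> \<alpha> ` S = S \<and> card S = 2 * k}"
        and S': "S' \<in> {S. S \<subseteq> {1..2 * n} \<and> \<alpha> ` S = S \<and> card S = 2 * k}" and eq: "?T S = ?T S'"
      have "S = ?T S \<union> \<alpha> ` ?T S" using S by (intro invariant_set_eq_pairs(1)[OF \<alpha>]) auto
      also have "\<dots> = ?T S' \<union> \<alpha> ` ?T S'" by (simp only: eq)
      also have "\<dots> = S'" using S' by (intro invariant_set_eq_pairs(1)[OF \<alpha>, symmetric]) auto
      finally show "S = S'" .
    qed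
    show "?T ` {S. S \<subseteq> {1..2 * n} \<and> \<alpha> ` S = S \<and> card S = 2 * k} \<subseteq> {T. T \<subseteq> ?R \<and> card T = k}"
      using invariant_set_eq_pairs(2)[OF \<alpha>] by auto
  qed simp
  then show ?thesis using n_subsets[of ?R k] R by simp
qed

text \<open>A permutation preserving \<open>S\<close> also preserves the complement, and its two
  restrictions determine it.\<close>

lemma card_permutations_preserving_le:
  assumes fin: "finite A" and S: "S \<subseteq> A"
  shows "card {\<phi>. \<phi> permutes A \<and> \<phi> ` S = S} \<le> fact (card S) * fact (card A - card S)"
proof -
  let ?f = "\<lambda>\<phi>. (perm_restrict \<phi> S, perm_restrict \<phi> (A - S))"
  have finS: "finite S" using fin S finite_subset by blast
  have res: "perm_restrict \<phi> B permutes B" if "\<phi> permutes A" "\<phi> ` B = B" for \<phi> B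
  proof (rule bij_imp_permutes)
    have "bij_betw \<phi> B B" using that permutes_inj_on[OF that(1)] by (simp add: bij_betw_def)
    then show "bij_betw (perm_restrict \<phi> B) B B"
      by (subst bij_betw_cong[of B _ \<phi>]) (auto simp: perm_restrict_simps)
  qed (simp add: perm_restrict_simps)
  have "card {\<phi>. \<phi> permutes A \<and> \<phi> ` S = S} \<le> card ({p. p permutes S} \<times> {p. p permutes (A - S)})"
  proof (rule card_inj_on_le)
    show "inj_on ?f {\<phi>. \<phi> permutes A \<and> \<phi> ` S = S}"
    proof (rule inj_onI, rule ext)
      fix p q x assume p: "p \<in> {\<phi>. \<phi> permutes A \<and> \<phi> ` S = S}"
        and q: "q \<in> {\<phi>. \<phi> permutes A \<and> \<phi> ` S = S}" and eq: "?f p = ?f q"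
      consider "x \<in> S" | "x \<in> A - S" | "x \<notin> A" by blast
      then show "p x = q x"
      proof cases
        case 3 then show ?thesis using p q by (simp add: permutes_def)
      qed (use eq in \<open>metis perm_restrict_simps(1) prod.inject\<close>)+
    qed
    show "?f ` {\<phi>. \<phi> permutes A \<and> \<phi> ` S = S} \<subseteq> {p. p permutes S} \<times> {p. p permutes (A - S)}"
    proof (intro subsetI, elim imageE)
      fix y p assume y: "y = ?f p" and p: "p \<in> {\<phi>. \<phi> permutes A \<and> \<phi> ` S = S}"
      have "p ` (A - S) = A - S"
        using p permutes_image[of p A] permutes_inj[of p A] by (simp add: image_set_diff)
      then show "y \<in> {p. p permutes S} \<times> {p. p permutes (A - S)}" using y p res by auto
    qed
    show "finite ({p. p permutes S} \<times> {p. p permutes (A - S)})"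
      using fin finS by (simp add: finite_permutations)
  qed
  also have "\<dots> = fact (card S) * fact (card A - card S)"
    using fin finS S
    by (simp add: card_cartesian_product card_permutations[OF refl] card_Diff_subset)
  finally show ?thesis .
qed

text \<open>Union bound over the involution, the half-size \<open>k\<close> of an invariant set, and
  the set itself. What remains is to count the permutations preserving that set.\<close>

lemma card_disconnected_le:
  "card (fpf_involutions (2 * n) \<times> {\<phi>. \<phi> permutes {1..2 * n}} - labeled_maps n)
    \<le> card (fpf_involutions (2 * n)) *
      (\<Sum>k = 1..<n. (n choose k) * (fact (2 * k) * fact (2 * n - 2 * k)))"
proof -
  let ?A = "{1..2 * n}" and ?I = "fpf_involutions (2 * n)"
  let ?Inv = "\<lambda>\<alpha> k. {S. S \<subseteq> ?A \<and> \<alpha> ` S = S \<and> card S = 2 * k}"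
  let ?Stab = "\<lambda>S. {\<phi>. \<phi> permutes ?A \<and> \<phi> ` S = S}"
  let ?B = "?I \<times> {\<phi>. \<phi> permutes ?A} - labeled_maps n"
  let ?U = "\<lambda>\<alpha> k. \<Union>S\<in>?Inv \<alpha> k. {\<alpha>} \<times> ?Stab S"
  have finI: "finite ?I" by (rule finite_fpf_involutions)
  have fin_stab: "finite (?Stab S)" for S
    by (rule finite_subset[OF _ finite_permutations[of ?A]]) auto
  have "?B \<subseteq> (\<Union>\<alpha>\<in>?I. \<Union>k\<in>{1..<n}. ?U \<alpha> k)"
  proof (rule subsetI)
    fix x assume "x \<in> ?B"
    then obtain \<alpha> \<phi> where x: "x = (\<alpha>, \<phi>)" and \<alpha>: "\<alpha> \<in> ?I" and \<phi>: "\<phi> permutes ?A"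
      and "(\<alpha>, \<phi>) \<notin> labeled_maps n" by auto
    then obtain S where S: "S \<subset> ?A" "S \<noteq> {}" "\<alpha> ` S = S" "\<phi> ` S = S"
      using disconnected_invariant_set by metis
    define k where "k = card {x \<in> S. x < \<alpha> x}"
    have k: "card S = 2 * k" using invariant_set_eq_pairs(2)[OF \<alpha> _ S(3)] S(1) by (auto simp: k_def)
    have "card S < 2 * n" using psubset_card_mono[OF _ S(1)] by simp
    moreover have "card S > 0" using S finite_subset[of S ?A] by (auto simp: card_gt_0_iff)
    ultimately have "k \<in> {1..<n}" using k by auto
    then show "x \<in> (\<Union>\<alpha>\<in>?I. \<Union>k\<in>{1..<n}. ?U \<alpha> k)" using x \<alpha> \<phi> S k by blast
  qed
  then have "card ?B \<le> card (\<Union>\<alpha>\<in>?I. \<Union>k\<in>{1..<n}. ?U \<alpha> k)"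
    by (intro card_mono finite_UN_I finI finite_SigmaI fin_stab) auto
  also have "\<dots> \<le> (\<Sum>\<alpha>\<in>?I. \<Sum>k = 1..<n. card (?U \<alpha> k))"
    by (rule order_trans[OF card_UN_le[OF finI]]) (intro sum_mono card_UN_le, simp)
  also have "\<dots> \<le> (\<Sum>\<alpha>\<in>?I. \<Sum>k = 1..<n. (n choose k) * (fact (2 * k) * fact (2 * n - 2 * k)))"
  proof (intro sum_mono)
    fix \<alpha> k assume \<alpha>: "\<alpha> \<in> ?I"
    have "card (?U \<alpha> k) \<le> (\<Sum>S\<in>?Inv \<alpha> k. card ({\<alpha>} \<times> ?Stab S))"
      by (intro card_UN_le) simp
    also have "\<dots> \<le> (\<Sum>S\<in>?Inv \<alpha> k. fact (2 * k) * fact (2 * n - 2 * k))"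
    proof (rule sum_mono)
      fix S assume "S \<in> ?Inv \<alpha> k"
      then have "S \<subseteq> ?A" "card S = 2 * k" by auto
      then show "card ({\<alpha>} \<times> ?Stab S) \<le> fact (2 * k) * fact (2 * n - 2 * k)"
        using card_permutations_preserving_le[of ?A S] by (simp add: card_cartesian_product)
    qed
    also have "\<dots> \<le> (n choose k) * (fact (2 * k) * fact (2 * n - 2 * k))"
      using card_invariant_sets_le[OF \<alpha>, of k] by simp
    finally show "card (?U \<alpha> k) \<le> (n choose k) * (fact (2 * k) * fact (2 * n - 2 * k))" .
  qed
  finally show ?thesis by simp
qed

section \<open>Binomial estimates and the resulting bound\<close>

lemma choose_square_le: "(n choose k)\<^sup>2 \<le> (2 * n) choose (2 * k)"
proof -
  \<comment> \<open>Rewritten as the single term \<open>j = k\<close> of Vandermonde's sum: choose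
    \<open>k\<close> elements from each half of a set of size \<open>2 * n\<close>.\<close>
  have "(n choose k)\<^sup>2 = (n choose k) * (n choose (2 * k - k))" by (simp add: power2_eq_square)
  also have "\<dots> \<le> (\<Sum>j\<le>2 * k. (n choose j) * (n choose (2 * k - j)))"
    by (rule member_le_sum) auto
  also have "\<dots> = (2 * n) choose (2 * k)" using vandermonde[of n n "2 * k"] by (simp add: mult_2)
  finally show ?thesis .
qed

text \<open>Binomial coefficients increase up to the middle. Past the middle, symmetry replaces
  \<open>k\<close> by \<open>n - k\<close>, which is still at least 2.\<close>

lemma choose_two_le_choose:
  assumes "2 \<le> k" "k + 2 \<le> n"
  shows "n choose 2 \<le> n choose k"
proof (cases "2 * k \<le> n")
  case True then show ?thesis using assms by (intro binomial_mono) auto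
next
  case False
  then have "n choose 2 \<le> n choose (n - k)" using assms by (intro binomial_mono) auto
  then show ?thesis using binomial_symmetric[of k n] assms by simp
qed

lemma sum_inverse_choose_le: "(\<Sum>k = 1..<n. 1 / real (n choose k)) \<le> 4 / real n"
proof (cases "n \<le> 1")
  case False
  then have n: "n \<ge> 2" by simp
  \<comment> \<open>\<open>?c\<close> is the inverse of \<open>n choose 2\<close> and bounds every
    term except \<open>k = 1\<close> and \<open>k = n - 1\<close>, which equal \<open>1 / n\<close>.
    Granting \<open>?c\<close> to all \<open>n - 1\<close> indices costs \<open>2 / n\<close>, hence
    4 in total. For \<open>n = 2\<close> the two end terms coincide and are merely counted
    twice.\<close>
  let ?c = "2 / (real n * (real n - 1))"
  let ?d = "\<lambda>j k. if k = j then 1 / real n else 0 :: real"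
  have c: "real (n choose 2) = real n * (real n - 1) / 2"
    using n by (simp add: choose_two real_of_nat_div of_nat_diff)
  have "(\<Sum>k = 1..<n. 1 / real (n choose k)) \<le> (\<Sum>k = 1..<n. ?d 1 k + ?d (n - 1) k + ?c)"
  proof (rule sum_mono)
    fix k assume k: "k \<in> {1..<n}"
    have c0: "?c \<ge> 0" using n by simp
    consider "k = 1" | "k = n - 1" | "2 \<le> k" "k + 2 \<le> n" using k by fastforce
    then show "1 / real (n choose k) \<le> ?d 1 k + ?d (n - 1) k + ?c"
    proof cases
      case 1 then show ?thesis using c0 by simp
    next
      case 2
      then have "n choose k = n" using binomial_symmetric[of 1 n] n by simp
      then show ?thesis using c0 2 by simp
    next
      case 3
      have "real (n choose 2) > 0" using n by (simp add: zero_less_binomial_iff)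
      then have "1 / real (n choose k) \<le> 1 / real (n choose 2)"
        using choose_two_le_choose[OF 3] 3 by (intro divide_left_mono mult_pos_pos) auto
      also have "\<dots> = ?c" unfolding c by simp
      finally show ?thesis by (simp add: add_increasing)
    qed
  qed
  also have "\<dots> = 1 / real n + 1 / real n + (real n - 1) * ?c"
  proof -
    have "(\<Sum>k = 1..<n. ?d 1 k) = 1 / real n" "(\<Sum>k = 1..<n. ?d (n - 1) k) = 1 / real n"
      using n by (simp_all add: sum.delta)
    moreover have "(\<Sum>k = 1..<n. ?c) = (real n - 1) * ?c" using n by (simp add: of_nat_diff)
    ultimately show ?thesis by (simp only: sum.distrib)
  qed
  also have "\<dots> = 4 / real n" using n by (simp add: field_simps)
  finally show ?thesis .
qed simp

lemma disconnected_proportion_le: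
  "real (card (fpf_involutions (2 * n) \<times> {\<phi>. \<phi> permutes {1..2 * n}} - labeled_maps n))
    / real (card (fpf_involutions (2 * n) \<times> {\<phi>. \<phi> permutes {1..2 * n}})) \<le> 4 / real n"
    (is "real ?b / real ?w \<le> _")
proof -
  let ?i = "card (fpf_involutions (2 * n))"
  have i: "real ?i > 0"
    using finite_fpf_involutions fpf_involutions_nonempty by (simp add: card_gt_0_iff)
  have w: "real ?w = real ?i * fact (2 * n)"
    by (simp add: card_cartesian_product card_permutations[OF refl])
  have "real ?b \<le> real (?i * (\<Sum>k = 1..<n. (n choose k) * (fact (2 * k) * fact (2 * n - 2 * k))))"
    by (rule of_nat_mono[OF card_disconnected_le])
  also have "\<dots> = real ?i * (\<Sum>k = 1..<n. real (n choose k) * (fact (2 * k) * fact (2 * n - 2 * k)))"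
    by simp
  finally have "real ?b / real ?w \<le>
      real ?i * (\<Sum>k = 1..<n. real (n choose k) * (fact (2 * k) * fact (2 * n - 2 * k))) / real ?w"
    by (rule divide_right_mono) simp
  also have "\<dots> = (\<Sum>k = 1..<n. real (n choose k) * (fact (2 * k) * fact (2 * n - 2 * k)) / fact (2 * n))"
    unfolding w sum_divide_distrib[symmetric] using i by simp
  also have "\<dots> \<le> (\<Sum>k = 1..<n. 1 / real (n choose k))"
  proof (rule sum_mono)
    fix k assume "k \<in> {1..<n}"
    then have k: "k \<le> n" by simp
    let ?x = "real (n choose k)" and ?y = "real ((2 * n) choose (2 * k))"
    have x: "?x > 0" using k by (simp add: zero_less_binomial_iff)
    have y: "?y > 0" using k by (simp add: zero_less_binomial_iff)
    have "?y = fact (2 * n) / (fact (2 * k) * fact (2 * n - 2 * k))"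
      using k by (intro binomial_fact) simp
    \<comment> \<open>\<open>?x\<close> bounds the number of invariant sets of size
      \<open>2 * k\<close>, and \<open>1 / ?y\<close> the chance that a uniform permutation
      preserves a given one. Since \<open>?x\<close> squared is at most \<open>?y\<close>, the
      quotient is at most \<open>1 / ?x\<close>.\<close>
    then have "?x * (fact (2 * k) * fact (2 * n - 2 * k)) / fact (2 * n) = ?x / ?y"
      by simp
    also have "\<dots> \<le> 1 / ?x"
    proof -
      have "real ((n choose k)\<^sup>2) \<le> ?y" by (rule of_nat_mono[OF choose_square_le])
      then show ?thesis using x y by (simp add: field_simps power2_eq_square)
    qed
    finally show "?x * (fact (2 * k) * fact (2 * n - 2 * k)) / fact (2 * n) \<le> 1 / ?x" .
  qed
  also have "\<dots> \<le> 4 / real n" by (rule sum_inverse_choose_le)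
  finally show ?thesis .
qed

theorem theorem1:
  shows "\<exists>C::real. C > 0 \<and> (\<forall>n::nat. n \<ge> 1 \<longrightarrow>
    tv_dist (map_pmf Some (uniform_labeled_map n))
      (bind_pmf (uniform_cycle_lengths (2 * n)) (polygon_gluing n)) \<le> C / real n)"
proof (intro exI[of _ 4] conjI allI impI)
  fix n :: nat
  let ?W = "fpf_involutions (2 * n) \<times> {\<phi>. \<phi> permutes {1..2 * n}}"
  have "finite ?W" by (intro finite_cartesian_product finite_fpf_involutions finite_permutations) simp
  moreover have "?W \<noteq> {}"
    using fpf_involutions_nonempty[of n] permutations_nonempty[of "{1..2 * n}"] by blast
  moreover have "labeled_maps n \<subseteq> ?W" by (auto simp: labeled_maps_def)
  ultimately have "tv_dist (map_pmf Some (uniform_labeled_map n))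
      (bind_pmf (uniform_cycle_lengths (2 * n)) (polygon_gluing n))
    \<le> real (card (?W - labeled_maps n)) / real (card ?W)"
    unfolding law_of_gluing uniform_labeled_map_def by (rule tv_dist_uniform_subset_le)
  also have "\<dots> \<le> 4 / real n" by (rule disconnected_proportion_le)
  finally show "tv_dist (map_pmf Some (uniform_labeled_map n))
      (bind_pmf (uniform_cycle_lengths (2 * n)) (polygon_gluing n)) \<le> 4 / real n" .
qed simp

end
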